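(* Let $n\ge1$, and for $r=1,2$ let $\vec{\alpha_r}=(\alpha_{r1},\dots,\alpha_{rn})$ with all $\alpha_{ri}>0$ and $\vec{p_r}=(p_{r1},\dots,p_{rn})$ with all $0<p_{ri}<1$. Let $\mathcal{N}_r=\sum_{i=1}^n N_{\alpha_{ri},p_{ri}}$, a sum of independent negative binomial random variables. If $(\vec{\alpha_1},\vec{p_1})$ is smaller than $(\vec{\alpha_2},\vec{p_2})$ in the reverse-coupled weakly sub-sup majorization order, then $\mathcal{N}_1\le_{conv}\mathcal{N}_2$.
   Context: Negative binomial variables: for $\alpha>0$, $0<p<1$, $q=1-p$, $P(N_{\alpha,p}=k)=\binom{k+\alpha-1}{k}p^\alpha q^k$ for $k=0,1,2,\dots$. $X_1\le_{conv}X_2$ means $X_2$ has the same distribution as $X_1+Z$ for some nonnegative random variable $Z$ independent of $X_1$. For $\vec{x},\vec{y}\in\mathbb{R}^m$, $\vec{x}\prec\vec{y}$ (majorization) means that the sum of the $k$ largest components of $\vec{x}$ is at most that of $\vec{y}$ for $k=1,\dots,m$, with equality for $k=m$. Let $\mathcal{A}$ be the set of vector pairs $(\vec{x},\vec{y})\in\mathbb{R}^n\times\mathbb{R}^n$ modulo simultaneous permutation of the coordinates of $\vec x$ and $\vec y$ by the same permutation. The reverse-coupled weakly sub-sup majorization order is the order on $\mathcal{A}$ generated by the following relations, i.e. $(\vec{x},\vec{y})$ is smaller than $(\vec{x}',\vec{y}')$ if there is a finite chain of elements of $\mathcal{A}$ from $(\vec{x},\vec{y})$ to $(\vec{x}',\vec{y}')$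 in which each consecutive pair $(\vec{x_1},\vec{y_1})$, $(\vec{x_2},\vec{y_2})$ satisfies one of: (i) for some $1\le i<j\le n$ with $(y_{2j}-y_{2i})(x_{2j}-x_{2i})\le0$: $(x_{1i},x_{1j})\prec(x_{2i},x_{2j})$, $x_{1m}=x_{2m}$ for $m\ne i,j$, and $\vec{y_1}=\vec{y_2}$; (ii) for some $1\le i<j\le n$ with $(y_{2j}-y_{2i})(x_{2j}-x_{2i})\le0$: $(y_{1i},y_{1j})\prec(y_{2i},y_{2j})$, $y_{1m}=y_{2m}$ for $m\ne i,j$, and $\vec{x_1}=\vec{x_2}$; (iii) $x_{1i}\le x_{2i}$ for all $i$ and $\vec{y_1}=\vec{y_2}$; (iv) $y_{1i}\ge y_{2i}$ for all $i$ and $\vec{x_1}=\vec{x_2}$. *)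

theory Defs
  imports "HOL-Probability.Probability"
begin

definition top_sum :: "nat \<Rightarrow> real list \<Rightarrow> real" where
  "top_sum k xs = sum_list (take k (rev (sort xs)))"

definition majorized :: "real list \<Rightarrow> real list \<Rightarrow> bool" where
  "majorized xs ys \<longleftrightarrow> length xs = length ys \<and>
     (\<forall>k\<in>{1..length xs}. top_sum k xs \<le> top_sum k ys) \<and>
     top_sum (length xs) xs = top_sum (length ys) ys"

definition sim_perm :: "(((real^'n) \<times> (real^'n)) \<times> ((real^'n) \<times> (real^'n))) set" where
  "sim_perm = {((x, y), (x', y')). \<exists>\<pi>. bij \<pi> \<and> (\<forall>i. x' $ i = x $ \<pi> i \<and> y' $ i = y $ \<pi> i)}"

text \<open>
  The coordinates carry no order here. The relations below do not change when \<open>i\<close> and \<open>j\<close> are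
  exchanged, so choosing \<open>i \<noteq> j\<close> amounts to choosing \<open>i < j\<close> in an enumeration of the coordinates.
\<close>
definition rc_rel_1 ::
    "real^'n \<Rightarrow> real^'n \<Rightarrow> real^'n \<Rightarrow> real^'n \<Rightarrow> bool" where
  "rc_rel_1 x1 y1 x2 y2 \<longleftrightarrow>
     (\<exists>i j. i \<noteq> j \<and> (y2 $ j - y2 $ i) * (x2 $ j - x2 $ i) \<le> 0 \<and>
        majorized [x1 $ i, x1 $ j] [x2 $ i, x2 $ j] \<and>
        (\<forall>m. m \<noteq> i \<and> m \<noteq> j \<longrightarrow> x1 $ m = x2 $ m)) \<and>
     y1 = y2"

definition rc_rel_2 ::
    "real^'n \<Rightarrow> real^'n \<Rightarrow> real^'n \<Rightarrow> real^'n \<Rightarrow> bool" where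
  "rc_rel_2 x1 y1 x2 y2 \<longleftrightarrow>
     (\<exists>i j. i \<noteq> j \<and> (y2 $ j - y2 $ i) * (x2 $ j - x2 $ i) \<le> 0 \<and>
        majorized [y1 $ i, y1 $ j] [y2 $ i, y2 $ j] \<and>
        (\<forall>m. m \<noteq> i \<and> m \<noteq> j \<longrightarrow> y1 $ m = y2 $ m)) \<and>
     x1 = x2"

definition rc_rel_3 ::
    "real^'n \<Rightarrow> real^'n \<Rightarrow> real^'n \<Rightarrow> real^'n \<Rightarrow> bool" where
  "rc_rel_3 x1 y1 x2 y2 \<longleftrightarrow> (\<forall>i. x1 $ i \<le> x2 $ i) \<and> y1 = y2"

definition rc_rel_4 ::
    "real^'n \<Rightarrow> real^'n \<Rightarrow> real^'n \<Rightarrow> real^'n \<Rightarrow> bool" where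
  "rc_rel_4 x1 y1 x2 y2 \<longleftrightarrow> (\<forall>i. y1 $ i \<ge> y2 $ i) \<and> x1 = x2"

definition pair_class :: "real^'n \<Rightarrow> real^'n \<Rightarrow> ((real^'n) \<times> (real^'n)) set" where
  "pair_class x y = sim_perm `` {(x, y)}"

definition rc_step :: "((real^'n) \<times> (real^'n)) set \<Rightarrow> ((real^'n) \<times> (real^'n)) set \<Rightarrow> bool" where
  "rc_step C D \<longleftrightarrow> (\<exists>x1 y1 x2 y2. C = pair_class x1 y1 \<and> D = pair_class x2 y2 \<and>
     (rc_rel_1 x1 y1 x2 y2 \<or> rc_rel_2 x1 y1 x2 y2 \<or> rc_rel_3 x1 y1 x2 y2 \<or> rc_rel_4 x1 y1 x2 y2))"

text \<open>
  The reverse-coupled weakly sub-sup majorization order, on the classes \<^term>\<open>UNIV // sim_perm\<close>.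
  The intermediate classes of a chain are arbitrary: their coordinates need not be positive or
  lie in the unit interval.
\<close>
definition rc_weak_subsup_le ::
    "((real^'n) \<times> (real^'n)) set \<Rightarrow> ((real^'n) \<times> (real^'n)) set \<Rightarrow> bool" where
  "rc_weak_subsup_le = rc_step\<^sup>*\<^sup>*"

definition neg_binomial_rv :: "'a measure \<Rightarrow> ('a \<Rightarrow> nat) \<Rightarrow> real \<Rightarrow> real \<Rightarrow> bool" where
  "neg_binomial_rv M N \<alpha> p \<longleftrightarrow> N \<in> measurable M (count_space UNIV) \<and>
     (\<forall>k. measure M {\<omega> \<in> space M. N \<omega> = k} =
        ((real k + \<alpha> - 1) gchoose k) * p powr \<alpha> * (1 - p) ^ k)"

text \<open>
  The order compares distributions, and the space carrying \<open>X1\<close> may be too small for an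
  independent \<open>Z\<close>. So \<open>X1\<close> is replaced by a copy \<open>X\<close> on a new probability space. Taking that
  space over pairs of reals loses nothing: the product of the laws of \<open>X\<close> and \<open>Z\<close> lives there.
\<close>
definition conv_le :: "'a measure \<Rightarrow> ('a \<Rightarrow> real) \<Rightarrow> 'b measure \<Rightarrow> ('b \<Rightarrow> real) \<Rightarrow> bool" where
  "conv_le M1 X1 M2 X2 \<longleftrightarrow>
     X1 \<in> borel_measurable M1 \<and> X2 \<in> borel_measurable M2 \<and>
     (\<exists>(M :: (real \<times> real) measure) X Z.
        prob_space M \<and>
        X \<in> borel_measurable M \<and> distr M borel X = distr M1 borel X1 \<and>
        Z \<in> borel_measurable M \<and> (\<forall>\<omega>\<in>space M. 0 \<le> Z \<omega>) \<and>
        prob_space.indep_var M borel X borel Z \<and>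
        distr M2 borel X2 = distr M borel (\<lambda>\<omega>. X \<omega> + Z \<omega>))"

end

theory Submission
  imports Defs "HOL-Computational_Algebra.Formal_Power_Series"
begin

text \<open>
  A negative binomial law is compound Poisson with Levy weights \<open>\<alpha> q ^ k / k\<close> on \<open>k \<ge> 1\<close>, so the
  law of the second sum is that of the first one convolved with a compound Poisson law as soon as
  \<open>\<Sum>\<alpha>\<^sub>i q\<^sub>i ^ k\<close> grows for every \<open>k\<close>. Replacing \<open>\<alpha>\<close> and \<open>q\<close> by their positive parts extends this
  functional to arbitrary real vectors, where it stays monotone along every relation generating the
  order: \<open>x \<mapsto> (max 0 x) ^ k\<close> is convex and increasing, and the coupling condition makes the larger
  weight multiply the larger argument. Hence the intermediate classes need not be admissible
  parameters. The convolution factor is the quotient \<open>C\<close> of the two generating functions: it solves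
  \<open>C' = C (L\<^sub>2 - L\<^sub>1)\<close> with \<open>L\<^sub>2 - L\<^sub>1\<close> having nonnegative coefficients, which forces those of \<open>C\<close>
  to be nonnegative.
\<close>

unbundle no vec_syntax
unbundle fps_syntax

section \<open>Generating functions of sums of independent counting variables\<close>

text \<open>Formal rather than analytic: products, derivatives and quotients act on coefficients,
  with no radius of convergence to track.\<close>

definition pgf :: "'a measure \<Rightarrow> ('a \<Rightarrow> nat) \<Rightarrow> real fps" where
  "pgf M X = Abs_fps (\<lambda>k. measure M {\<omega> \<in> space M. X \<omega> = k})"

lemma pgf_nth: "pgf M X $ k = measure M {\<omega> \<in> space M. X \<omega> = k}"
  by (simp add: pgf_def)

lemma pgf_nth_distr:
  assumes [measurable]: "X \<in> measurable M (count_space UNIV)"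
  shows "pgf M X $ k = measure (distr M (count_space UNIV) X) {k}"
  by (simp add: pgf_nth measure_distr vimage_def Int_def conj_commute)

lemma (in prob_space) pgf_add:
  assumes indep: "indep_var (count_space UNIV) X (count_space UNIV) Y"
  shows "pgf M (\<lambda>\<omega>. X \<omega> + Y \<omega>) = pgf M X * pgf M Y"
proof (rule fps_ext)
  fix n
  have [measurable]: "random_variable (count_space UNIV) X" "random_variable (count_space UNIV) Y"
    using indep indep_var_rv1 indep_var_rv2 by blast+
  let ?A = "\<lambda>i. {\<omega> \<in> space M. X \<omega> = i \<and> Y \<omega> = n - i}"
  have "{\<omega> \<in> space M. X \<omega> + Y \<omega> = n} = (\<Union>i\<in>{0..n}. ?A i)"
    by auto
  hence "pgf M (\<lambda>\<omega>. X \<omega> + Y \<omega>) $ n = prob (\<Union>i\<in>{0..n}. ?A i)"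
    by (simp add: pgf_nth)
  also have "\<dots> = (\<Sum>i=0..n. prob (?A i))"
    by (intro finite_measure_finite_Union) (auto simp: disjoint_family_on_def)
  also have "\<dots> = (\<Sum>i=0..n. pgf M X $ i * pgf M Y $ (n - i))"
  proof (rule sum.cong[OF refl])
    fix i
    have "?A i = (\<lambda>\<omega>. (X \<omega>, Y \<omega>)) -` ({i} \<times> {n - i}) \<inter> space M"
      by auto
    hence "prob (?A i) = prob (X -` {i} \<inter> space M) * prob (Y -` {n - i} \<inter> space M)"
      using indep_varD[OF indep, of "{i}" "{n - i}"] by simp
    thus "prob (?A i) = pgf M X $ i * pgf M Y $ (n - i)"
      by (simp add: pgf_nth vimage_def Int_def conj_commute)
  qed
  finally show "pgf M (\<lambda>\<omega>. X \<omega> + Y \<omega>) $ n = (pgf M X * pgf M Y) $ n"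
    by (simp add: fps_mult_nth)
qed

text \<open>Functions of disjoint blocks of an independent family are independent; the blocks are
  \<open>{i}\<close> and \<open>I\<close>.\<close>

lemma (in prob_space) indep_var_count_space_sum:
  fixes X :: "'i \<Rightarrow> 'a \<Rightarrow> nat"
  assumes I: "finite I" "i \<notin> I" and indep: "indep_vars (\<lambda>_. count_space UNIV) X (insert i I)"
  shows "indep_var (count_space UNIV) (X i) (count_space UNIV) (\<lambda>\<omega>. \<Sum>i\<in>I. X i \<omega>)"
proof -
  have "indep_var
    (count_space UNIV) ((\<lambda>f. f i) \<circ> (\<lambda>\<omega>. restrict (\<lambda>i. X i \<omega>) {i}))
    (count_space UNIV) ((\<lambda>f. \<Sum>i\<in>I. f i) \<circ> (\<lambda>\<omega>. restrict (\<lambda>i. X i \<omega>) I))"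
    using I by (intro indep_var_compose[OF indep_var_restrict[OF indep]]) auto
  also have "((\<lambda>f. f i) \<circ> (\<lambda>\<omega>. restrict (\<lambda>i. X i \<omega>) {i})) = X i"
    by auto
  also have "((\<lambda>f. \<Sum>i\<in>I. f i) \<circ> (\<lambda>\<omega>. restrict (\<lambda>i. X i \<omega>) I)) = (\<lambda>\<omega>. \<Sum>i\<in>I. X i \<omega>)"
    by (auto cong: rev_conj_cong)
  finally show ?thesis .
qed

lemma (in prob_space) pgf_sum:
  fixes X :: "'i \<Rightarrow> 'a \<Rightarrow> nat"
  assumes "finite I" "indep_vars (\<lambda>_. count_space UNIV) X I"
  shows "pgf M (\<lambda>\<omega>. \<Sum>i\<in>I. X i \<omega>) = (\<Prod>i\<in>I. pgf M (X i))"
  using assms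
proof (induction I)
  case empty
  show ?case
    by (rule fps_ext) (auto simp: pgf_nth prob_space)
next
  case (insert i I)
  have "indep_vars (\<lambda>_. count_space UNIV) X I"
    using insert.prems by (rule indep_vars_subset) auto
  with insert show ?case
    using pgf_add[OF indep_var_count_space_sum[OF insert.hyps insert.prems]] by simp
qed

lemma (in prob_space) pgf_sums_one:
  assumes [measurable]: "random_variable (count_space UNIV) X"
  shows "(\<lambda>k. pgf M X $ k) sums 1"
proof -
  have "(\<lambda>k. prob {\<omega> \<in> space M. X \<omega> = k}) sums prob (\<Union>k. {\<omega> \<in> space M. X \<omega> = k})"
    by (intro finite_measure_UNION) (auto simp: disjoint_family_on_def)
  moreover have "(\<Union>k. {\<omega> \<in> space M. X \<omega> = k}) = space M"
    by auto
  ultimately show ?thesis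
    by (simp add: pgf_nth prob_space)
qed

lemma distr_count_space_eqI:
  fixes X :: "'a \<Rightarrow> nat" and Y :: "'b \<Rightarrow> nat"
  assumes "prob_space M" "prob_space N"
    and [measurable]: "X \<in> measurable M (count_space UNIV)" "Y \<in> measurable N (count_space UNIV)"
    and eq: "pgf M X = pgf N Y"
  shows "distr M (count_space UNIV) X = distr N (count_space UNIV) Y"
proof (rule measure_eqI_countable[of _ UNIV])
  interpret M: prob_space M by fact
  interpret N: prob_space N by fact
  fix a :: nat
  have "measure M {\<omega> \<in> space M. X \<omega> = a} = measure N {\<omega> \<in> space N. Y \<omega> = a}"
    using arg_cong[OF eq, of "\<lambda>f. f $ a"] by (simp add: pgf_nth)
  thus "emeasure (distr M (count_space UNIV) X) {a} = emeasure (distr N (count_space UNIV) Y) {a}"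
    by (simp add: emeasure_distr M.emeasure_eq_measure N.emeasure_eq_measure vimage_def Int_def conj_commute)
qed auto

section \<open>Logarithmic derivatives and quotients of formal power series\<close>

text \<open>
  The coefficients of the logarithmic derivative are \<open>(k + 1) \<nu>{k + 1}\<close>, where \<open>\<nu>\<close> is the
  Levy measure.
\<close>
lemma fps_deriv_pgf_neg_binomial:
  assumes "neg_binomial_rv M N \<alpha> p"
  shows "fps_deriv (pgf M N) = pgf M N * Abs_fps (\<lambda>k. \<alpha> * (1 - p) ^ Suc k)"
proof -
  let ?q = "1 - p" and ?L = "Abs_fps (\<lambda>k. \<alpha> * (1 - p) ^ Suc k)"
  have nth: "pgf M N $ k = ((real k + \<alpha> - 1) gchoose k) * p powr \<alpha> * ?q ^ k" for k
    using assms by (simp add: neg_binomial_rv_def pgf_nth)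
  \<comment> \<open>Absorption \<open>(k + 1) (a gchoose (k + 1)) = a ((a - 1) gchoose k)\<close>
    with \<open>a = k + \<alpha>\<close>.\<close>
  have rec: "of_nat (Suc k) * pgf M N $ Suc k = (real k + \<alpha>) * ?q * pgf M N $ k" for k
  proof -
    have "of_nat (Suc k) * pgf M N $ Suc k
        = (of_nat (Suc k) * ((real k + \<alpha>) gchoose Suc k)) * p powr \<alpha> * ?q ^ Suc k"
      unfolding nth by (simp add: add_ac)
    also have "\<dots> = (real k + \<alpha>) * ?q * pgf M N $ k"
      unfolding nth gbinomial_absorption by simp
    finally show ?thesis .
  qed
  \<comment> \<open>The factor \<open>1 - q X\<close> collapses the geometric series
    \<open>?L\<close> to the constant \<open>\<alpha> q\<close>. After multiplying by it, the claim
    is the recurrence \<open>rec\<close>; the factor has constant coefficient 1, so it can be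
    cancelled at the end.\<close>
  have nth_mult: "(F * (1 - fps_const ?q * fps_X)) $ n = F $ n - ?q * (if n = 0 then 0 else F $ (n - 1))"
    for F n
  proof -
    have "F * (1 - fps_const ?q * fps_X) = F - fps_const ?q * (F * fps_X)"
      by (simp only: right_diff_distrib mult_1_right mult.left_commute)
    thus ?thesis
      by (simp only: fps_sub_nth fps_mult_left_const_nth fps_X_mult_right_nth)
  qed
  have L: "?L * (1 - fps_const ?q * fps_X) = fps_const (\<alpha> * ?q)"
  proof (rule fps_ext)
    fix n show "(?L * (1 - fps_const ?q * fps_X)) $ n = fps_const (\<alpha> * ?q) $ n"
      unfolding nth_mult by (cases n) simp_all
  qed
  have "fps_deriv (pgf M N) * (1 - fps_const ?q * fps_X) = pgf M N * fps_const (\<alpha> * ?q)"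
  proof (rule fps_ext)
    fix n
    have deriv: "fps_deriv (pgf M N) $ k = (real k + \<alpha>) * ?q * pgf M N $ k" for k
      using rec[of k] by simp
    show "(fps_deriv (pgf M N) * (1 - fps_const ?q * fps_X)) $ n = (pgf M N * fps_const (\<alpha> * ?q)) $ n"
      unfolding nth_mult deriv[of n] fps_mult_right_const_nth
      by (cases n) (simp_all add: algebra_simps)
  qed
  also have "\<dots> = pgf M N * ?L * (1 - fps_const ?q * fps_X)"
    unfolding L[symmetric] by (simp add: mult.assoc)
  finally show ?thesis
    by (rule mult_right_cancel[THEN iffD1, rotated]) (auto simp: fps_eq_iff intro!: exI[of _ 0])
qed

lemma fps_deriv_prod_log:
  fixes G :: "'i \<Rightarrow> 'a::comm_ring_1 fps"
  assumes "finite I" "\<And>i. i \<in> I \<Longrightarrow> fps_deriv (G i) = G i * L i"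
  shows "fps_deriv (prod G I) = prod G I * sum L I"
  using assms by (induction I) (auto simp: algebra_simps)

text \<open>Comparing coefficients in \<open>C' = C (L - K)\<close> writes
  \<open>(n + 1) C_(n + 1)\<close> as a combination of \<open>C_0, ..., C_n\<close> with nonnegative
  weights. Strong induction starts from \<open>C_0 = B_0 / A_0 > 0\<close>.\<close>

lemma fps_quotient_nonneg:
  fixes A B K L :: "real fps"
  assumes A: "fps_deriv A = A * K" "A $ 0 > 0" and B: "fps_deriv B = B * L" "B $ 0 > 0"
    and le: "\<And>k. K $ k \<le> L $ k"
  obtains C where "B = A * C" "\<And>k. C $ k \<ge> 0"
proof -
  define C where "C = B * inverse A"
  have BAC: "B = A * C"
    using A(2) inverse_mult_eq_1'[of A] by (simp add: C_def mult.left_commute[of A B])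
  have "A * fps_deriv C = A * (C * (L - K))"
  proof -
    have "A * fps_deriv C + (A * K) * C = (A * C) * L"
      using B(1) unfolding BAC fps_deriv_mult A(1) .
    hence "A * fps_deriv C = (A * C) * L - (A * K) * C"
      by (simp only: eq_diff_eq)
    thus ?thesis
      by (simp only: right_diff_distrib mult.assoc mult.commute[of K])
  qed
  moreover have "A \<noteq> 0"
    using A(2) by auto
  ultimately have deriv: "fps_deriv C = C * (L - K)"
    by simp
  have "C $ k \<ge> 0" for k
  proof (induction k rule: less_induct)
    case (less k)
    show ?case
    proof (cases k)
      case 0
      then show ?thesis
        using A(2) B(2) by (simp add: C_def)
    next
      case (Suc n)
      have "of_nat (Suc n) * C $ Suc n = (\<Sum>i=0..n. C $ i * (L $ (n - i) - K $ (n - i)))"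
        using arg_cong[OF deriv, of "\<lambda>f. f $ n"] by (simp add: fps_mult_nth)
      also have "\<dots> \<ge> 0"
        using less Suc le by (intro sum_nonneg mult_nonneg_nonneg) auto
      finally show ?thesis
        using Suc by (simp add: zero_le_mult_iff)
    qed
  qed
  with BAC that show ?thesis by blast
qed

text \<open>A formal quotient need not be summable. Here nonnegativity gives
  \<open>A_0 C_k \<le> B_k\<close>, hence summability by comparison, and the Cauchy product then
  yields \<open>1 * (\<Sum>k. C_k) = 1\<close>.\<close>

lemma fps_quotient_sums_one:
  fixes A B C :: "real fps"
  assumes BAC: "B = A * C" and A: "(\<lambda>k. A $ k) sums 1" "\<And>k. A $ k \<ge> 0" "A $ 0 > 0"
    and B: "(\<lambda>k. B $ k) sums 1" and C: "\<And>k. C $ k \<ge> 0"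
  shows "(\<lambda>k. C $ k) sums 1"
proof -
  have B_nth: "B $ k = (\<Sum>i\<le>k. A $ i * C $ (k - i))" for k
    by (simp add: BAC fps_mult_nth atLeast0AtMost)
  have le: "A $ 0 * C $ k \<le> B $ k" for k
    unfolding B_nth using member_le_sum[of 0 "{..k}" "\<lambda>i. A $ i * C $ (k - i)"] A(2) C by simp
  have "summable (\<lambda>k. A $ 0 * C $ k)"
  proof (rule summable_comparison_test')
    show "summable (\<lambda>k. B $ k)"
      by (rule sums_summable[OF B])
    show "norm (A $ 0 * C $ n) \<le> B $ n" if "0 \<le> n" for n
      using le[of n] A(2)[of 0] C[of n] by simp
  qed
  hence summable: "summable (\<lambda>k. C $ k)"
    using A(3) by (simp add: summable_cmult_iff)
  have "(\<lambda>k. \<Sum>i\<le>k. A $ i * C $ (k - i)) sums ((\<Sum>k. A $ k) * (\<Sum>k. C $ k))"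
  proof (rule Cauchy_product_sums)
    show "summable (\<lambda>k. norm (A $ k))" "summable (\<lambda>k. norm (C $ k))"
      using sums_summable[OF A(1)] summable A(2) C by simp_all
  qed
  hence "(\<lambda>k. B $ k) sums ((\<Sum>k. A $ k) * (\<Sum>k. C $ k))"
    by (simp only: B_nth[symmetric])
  hence "(\<Sum>k. A $ k) * (\<Sum>k. C $ k) = 1"
    by (rule sums_unique2[OF _ B])
  hence "(\<Sum>k. C $ k) = 1"
    by (simp only: sums_unique[OF A(1), symmetric] mult_1)
  with summable show ?thesis
    by (metis summable_sums)
qed

section \<open>From a factorization of generating functions to the convolution order\<close>

lemma (in prob_space) distr_pair_snd:
  assumes "prob_space N"
  shows "distr (M \<Otimes>\<^sub>M N) N snd = N"
proof -
  have M: "emeasure M (space M) = 1"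
    by (rule emeasure_space_1)
  interpret N: prob_space N by fact
  interpret pair_prob_space M N ..
  show ?thesis
  proof (rule measure_eqI)
    fix A assume "A \<in> sets (distr (M \<Otimes>\<^sub>M N) N snd)"
    hence A: "A \<in> sets N" by simp
    hence "snd -` A \<inter> space (M \<Otimes>\<^sub>M N) = space M \<times> A"
      using sets.sets_into_space by (auto simp: space_pair_measure)
    with A show "emeasure (distr (M \<Otimes>\<^sub>M N) N snd) A = emeasure N A"
      by (simp add: emeasure_distr N.emeasure_pair_measure_Times M)
  qed simp
qed

lemma indep_var_pair_measure:
  assumes "prob_space P" "prob_space Q"
  shows "prob_space.indep_var (P \<Otimes>\<^sub>M Q) P fst Q snd"
proof -
  interpret P: prob_space P by fact
  interpret Q: prob_space Q by fact
  interpret PQ: pair_prob_space P Q ..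
  show ?thesis
    unfolding PQ.indep_var_distribution_eq
    by (simp add: Q.distr_pair_fst prob_space.distr_pair_snd[OF assms] distr_id2)
qed

text \<open>The coefficients of \<open>C\<close> form a probability mass function \<open>Q\<close>.
  Under the product of the law of \<open>S\<close> with \<open>Q\<close>, the sum of the coordinates
  has the generating function of \<open>T\<close>, hence its law.\<close>

lemma conv_leI_pgf:
  fixes S :: "'a \<Rightarrow> nat" and T :: "'b \<Rightarrow> nat"
  assumes "prob_space M" "prob_space N"
    and S[measurable]: "S \<in> measurable M (count_space UNIV)"
    and T[measurable]: "T \<in> measurable N (count_space UNIV)"
    and C: "pgf N T = pgf M S * C" "\<And>k. C $ k \<ge> 0" "(\<lambda>k. C $ k) sums 1"
  shows "conv_le M (\<lambda>\<omega>. real (S \<omega>)) N (\<lambda>\<omega>. real (T \<omega>))"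
proof -
  interpret M: prob_space M by fact
  interpret N: prob_space N by fact
  define P where "P = distr M (count_space UNIV) S"
  define Q where "Q = embed_pmf (\<lambda>k. C $ k)"
  have "(\<integral>\<^sup>+ k. ennreal (C $ k) \<partial>count_space UNIV) = 1"
    using C by (simp add: nn_integral_count_space_nat suminf_ennreal2 sums_iff)
  hence pmf_Q: "pmf Q k = C $ k" for k
    unfolding Q_def using C(2) by (intro pmf_embed_pmf)
  interpret P: prob_space P
    unfolding P_def by (rule M.prob_space_distr) simp
  interpret PQ: pair_prob_space P "measure_pmf Q" ..
  have sets_P [measurable_cong]: "sets P = sets (count_space UNIV)"
    by (simp add: P_def)
  \<comment> \<open>Composing with \<open>id\<close> replaces the targets \<open>P\<close> and
    \<open>Q\<close> by \<open>count_space UNIV\<close>, which has the same measurable sets.\<close>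
  have indep: "PQ.indep_var (count_space UNIV) fst (count_space UNIV) snd"
    using PQ.indep_var_compose[OF indep_var_pair_measure[OF P.prob_space_axioms measure_pmf.prob_space_axioms[of Q]],
        of id "count_space UNIV" id "count_space UNIV"]
    by (simp add: measurable_cong_sets[OF sets_P refl])
  let ?W = "P \<Otimes>\<^sub>M measure_pmf Q"
  have sets_W [measurable_cong]: "sets ?W = sets (count_space UNIV \<Otimes>\<^sub>M count_space UNIV)"
    by (rule sets_pair_measure_cong) (simp_all add: sets_P)
  have "distr ?W (count_space UNIV) fst = distr ?W P fst"
    by (rule distr_cong) (simp_all add: sets_P)
  also have "\<dots> = P"
    by (rule prob_space.distr_pair_fst[OF measure_pmf.prob_space_axioms])
  finally have distr_fst: "distr ?W (count_space UNIV) fst = distr M (count_space UNIV) S"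
    by (simp add: P_def)
  have "distr ?W (count_space UNIV) snd = distr ?W (measure_pmf Q) snd"
    by (rule distr_cong) simp_all
  also have "\<dots> = measure_pmf Q"
    by (rule P.distr_pair_snd[OF measure_pmf.prob_space_axioms])
  finally have distr_snd: "distr ?W (count_space UNIV) snd = measure_pmf Q" .
  have "pgf ?W fst = pgf M S"
    by (rule fps_ext) (simp add: pgf_nth_distr distr_fst)
  moreover have "pgf ?W snd = C"
    by (rule fps_ext) (simp add: pgf_nth_distr distr_snd measure_pmf_single pmf_Q)
  ultimately have pgf_W: "pgf ?W (\<lambda>\<omega>. fst \<omega> + snd \<omega>) = pgf N T"
    using PQ.pgf_add[OF indep] C(1) by simp
  have law_sum: "distr ?W (count_space UNIV) (\<lambda>\<omega>. fst \<omega> + snd \<omega>) = distr N (count_space UNIV) T"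
    by (rule distr_count_space_eqI[OF PQ.prob_space_axioms N.prob_space_axioms _ T pgf_W]) simp
  \<comment> \<open>\<open>conv_le\<close> asks for a measure on pairs of reals, so the product on
    pairs of naturals is pushed forward.\<close>
  let ?M = "distr ?W (borel \<Otimes>\<^sub>M borel) (\<lambda>\<omega>. (real (fst \<omega>), real (snd \<omega>)))"
  have real_W: "(\<lambda>\<omega>. (real (fst \<omega>), real (snd \<omega>))) \<in> measurable ?W (borel \<Otimes>\<^sub>M borel)"
    by measurable
  interpret M': prob_space ?M
    by (rule PQ.prob_space_distr) (rule real_W)
  have law_fst: "distr ?M borel fst = distr M borel (\<lambda>\<omega>. real (S \<omega>))"
  proof -
    have "distr ?M borel fst = distr (distr ?W (count_space UNIV) fst) borel real"
      by (simp add: distr_distr o_def)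
    also have "\<dots> = distr M borel (\<lambda>\<omega>. real (S \<omega>))"
      unfolding distr_fst by (simp add: distr_distr o_def)
    finally show ?thesis .
  qed
  \<comment> \<open>The witness for \<open>Z\<close> is \<open>\<bar>snd \<omega>\<bar>\<close>:
    \<open>conv_le\<close> wants nonnegativity at every point of the space, whereas
    \<open>snd\<close> is nonnegative only almost surely under \<open>?M\<close>. The absolute value
    leaves the law unchanged, since the second coordinate comes from a natural number.\<close>
  have law_add: "distr N borel (\<lambda>\<omega>. real (T \<omega>)) = distr ?M borel (\<lambda>\<omega>. fst \<omega> + \<bar>snd \<omega>\<bar>)"
  proof -
    have "distr ?M borel (\<lambda>\<omega>. fst \<omega> + \<bar>snd \<omega>\<bar>)
        = distr (distr ?W (count_space UNIV) (\<lambda>\<omega>. fst \<omega> + snd \<omega>)) borel real"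
      by (simp add: distr_distr o_def)
    also have "\<dots> = distr N borel (\<lambda>\<omega>. real (T \<omega>))"
      unfolding law_sum by (simp add: distr_distr o_def)
    finally show ?thesis by simp
  qed
  have indep_real: "PQ.indep_var borel (\<lambda>\<omega>. real (fst \<omega>)) borel (\<lambda>\<omega>. real (snd \<omega>))"
    using PQ.indep_var_compose[OF indep, of real borel real borel] by (simp add: o_def)
  \<comment> \<open>By independence on \<open>?W\<close> the product of the marginals is the joint
    law, which is \<open>?M\<close> itself.\<close>
  have "distr ?M borel fst \<Otimes>\<^sub>M distr ?M borel snd = ?M"
    using indep_real unfolding PQ.indep_var_distribution_eq by (simp add: distr_distr o_def)
  hence "M'.indep_var borel fst borel snd"
    unfolding M'.indep_var_distribution_eq by (simp add: distr_id2)
  hence indep_M: "M'.indep_var borel fst borel (\<lambda>\<omega>. \<bar>snd \<omega>\<bar>)"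
    using M'.indep_var_compose[of borel fst borel snd id borel abs borel] by (simp add: o_def)
  show ?thesis
    unfolding conv_le_def
    by (intro conjI exI[of _ ?M] exI[of _ "fst :: real \<times> real \<Rightarrow> real"]
        exI[of _ "\<lambda>\<omega> :: real \<times> real. \<bar>snd \<omega>\<bar>"] ballI abs_ge_zero
        M'.prob_space_axioms law_fst law_add indep_M) measurable
qed

section \<open>Comparison of negative binomial sums through their Levy weights\<close>

lemma prod_fps_nth_0_pos:
  fixes G :: "'i \<Rightarrow> real fps"
  assumes "finite I" "\<And>i. i \<in> I \<Longrightarrow> G i $ 0 > 0"
  shows "prod G I $ 0 > 0"
  using assms by (induction I) auto

text \<open>Logarithmic derivatives turn the products of generating functions into sums, so
  \<open>le\<close> is exactly the coefficientwise comparison required by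
  \<open>fps_quotient_nonneg\<close>.\<close>

lemma conv_le_sum_neg_binomial:
  fixes N1 :: "'i::finite \<Rightarrow> 'a \<Rightarrow> nat" and N2 :: "'j::finite \<Rightarrow> 'b \<Rightarrow> nat"
  assumes M1: "prob_space M1" "prob_space.indep_vars M1 (\<lambda>_. count_space UNIV) N1 UNIV"
    and N1: "\<And>i. neg_binomial_rv M1 (N1 i) (\<alpha>1 i) (p1 i)" "\<And>i. 0 < p1 i"
    and M2: "prob_space M2" "prob_space.indep_vars M2 (\<lambda>_. count_space UNIV) N2 UNIV"
    and N2: "\<And>i. neg_binomial_rv M2 (N2 i) (\<alpha>2 i) (p2 i)" "\<And>i. 0 < p2 i"
    and le: "\<And>k. (\<Sum>i\<in>UNIV. \<alpha>1 i * (1 - p1 i) ^ Suc k) \<le> (\<Sum>i\<in>UNIV. \<alpha>2 i * (1 - p2 i) ^ Suc k)"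
  shows "conv_le M1 (\<lambda>\<omega>. \<Sum>i\<in>UNIV. real (N1 i \<omega>)) M2 (\<lambda>\<omega>. \<Sum>i\<in>UNIV. real (N2 i \<omega>))"
proof -
  let ?S = "\<lambda>\<omega>. \<Sum>i\<in>UNIV. N1 i \<omega>" and ?T = "\<lambda>\<omega>. \<Sum>i\<in>UNIV. N2 i \<omega>"
  let ?L1 = "\<lambda>i. Abs_fps (\<lambda>k. \<alpha>1 i * (1 - p1 i) ^ Suc k)"
  let ?L2 = "\<lambda>i. Abs_fps (\<lambda>k. \<alpha>2 i * (1 - p2 i) ^ Suc k)"
  have [measurable]: "N1 i \<in> measurable M1 (count_space UNIV)" for i
    using N1(1)[of i] by (simp add: neg_binomial_rv_def)
  have [measurable]: "N2 i \<in> measurable M2 (count_space UNIV)" for i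
    using N2(1)[of i] by (simp add: neg_binomial_rv_def)
  have S: "?S \<in> measurable M1 (count_space UNIV)" and T: "?T \<in> measurable M2 (count_space UNIV)"
    by measurable
  have pgf_S: "pgf M1 ?S = (\<Prod>i\<in>UNIV. pgf M1 (N1 i))"
    by (rule prob_space.pgf_sum[OF M1(1) _ M1(2)]) simp
  have pgf_T: "pgf M2 ?T = (\<Prod>i\<in>UNIV. pgf M2 (N2 i))"
    by (rule prob_space.pgf_sum[OF M2(1) _ M2(2)]) simp
  have deriv_S: "fps_deriv (pgf M1 ?S) = pgf M1 ?S * sum ?L1 UNIV"
    unfolding pgf_S by (rule fps_deriv_prod_log) (simp_all only: finite fps_deriv_pgf_neg_binomial[OF N1(1)])
  have deriv_T: "fps_deriv (pgf M2 ?T) = pgf M2 ?T * sum ?L2 UNIV"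
    unfolding pgf_T by (rule fps_deriv_prod_log) (simp_all only: finite fps_deriv_pgf_neg_binomial[OF N2(1)])
  \<comment> \<open>Each factor has constant coefficient \<open>p powr \<alpha> > 0\<close>, the
    probability of the value 0.\<close>
  have S_0: "pgf M1 ?S $ 0 > 0"
    unfolding pgf_S
  proof (rule prod_fps_nth_0_pos)
    show "pgf M1 (N1 i) $ 0 > 0" for i
      using N1(1)[of i] N1(2)[of i] by (simp add: neg_binomial_rv_def pgf_nth)
  qed simp
  have T_0: "pgf M2 ?T $ 0 > 0"
    unfolding pgf_T
  proof (rule prod_fps_nth_0_pos)
    show "pgf M2 (N2 i) $ 0 > 0" for i
      using N2(1)[of i] N2(2)[of i] by (simp add: neg_binomial_rv_def pgf_nth)
  qed simp
  have "sum ?L1 UNIV $ k \<le> sum ?L2 UNIV $ k" for k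
    using le[of k] by (simp only: fps_sum_nth fps_nth_Abs_fps)
  then obtain C where C: "pgf M2 ?T = pgf M1 ?S * C" "\<And>k. C $ k \<ge> 0"
    using fps_quotient_nonneg[OF deriv_S S_0 deriv_T T_0] by blast
  have "(\<lambda>k. C $ k) sums 1"
    by (rule fps_quotient_sums_one[OF C(1) prob_space.pgf_sums_one[OF M1(1) S] _ S_0
          prob_space.pgf_sums_one[OF M2(1) T] C(2)]) (simp add: pgf_nth)
  from conv_leI_pgf[OF M1(1) M2(1) S T C this] show ?thesis
    by simp
qed

unbundle no fps_syntax
unbundle vec_syntax

section \<open>Majorization of pairs and convex functions\<close>

lemma top_sum_pair: "top_sum (Suc 0) [a, b] = max a b" "top_sum (Suc (Suc 0)) [a, b] = a + b"
  by (auto simp: top_sum_def max_def numeral_2_eq_2)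

lemma majorized_pair_iff: "majorized [a, b] [c, d] \<longleftrightarrow> max a b \<le> max c d \<and> a + b = c + d"
proof -
  have "{1..length [a, b]} = {Suc 0, Suc (Suc 0)}"
    by auto
  hence "majorized [a, b] [c, d] \<longleftrightarrow> (max a b \<le> max c d \<and> a + b \<le> c + d) \<and> a + b = c + d"
    unfolding majorized_def by (simp only: top_sum_pair list.size) (simp add: top_sum_pair)
  thus ?thesis by linarith
qed

text \<open>The positive part is convex with values in \<open>{0..}\<close>, where
  \<open>x ^ k\<close> is convex and increasing.\<close>

lemma convex_on_power_pos_part: "convex_on UNIV (\<lambda>x::real. max 0 x ^ k)"
proof (rule convex_onI)
  fix t x y :: real
  assume t: "t > 0" "t < 1"
  have pow: "convex_on {0..} (\<lambda>x::real. x ^ k)"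
    using convex_power_odd convex_on_subset[OF convex_power_even] by (cases "even k") auto
  have "(1 - t) * x \<le> (1 - t) * max 0 x" "t * y \<le> t * max 0 y"
    "0 \<le> (1 - t) * max 0 x" "0 \<le> t * max 0 y"
    using t by (auto intro!: mult_left_mono mult_nonneg_nonneg)
  hence "max 0 ((1 - t) *\<^sub>R x + t *\<^sub>R y) \<le> (1 - t) *\<^sub>R max 0 x + t *\<^sub>R max 0 y"
    by simp
  hence "max 0 ((1 - t) *\<^sub>R x + t *\<^sub>R y) ^ k \<le> ((1 - t) *\<^sub>R max 0 x + t *\<^sub>R max 0 y) ^ k"
    by (intro power_mono) auto
  also have "\<dots> \<le> (1 - t) * max 0 x ^ k + t * max 0 y ^ k"
    using convex_onD[OF pow] t by simp
  finally show "max 0 ((1 - t) *\<^sub>R x + t *\<^sub>R y) ^ k \<le> (1 - t) * max 0 x ^ k + t * max 0 y ^ k" .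
qed auto

lemma mono_power_pos_part: "mono (\<lambda>x::real. max 0 x ^ k)"
  by (auto intro!: monoI power_mono)

text \<open>Both \<open>a\<close> and \<open>b\<close> lie between \<open>c\<close> and
  \<open>d\<close>, as convex combinations with swapped weights \<open>t\<close> and
  \<open>1 - t\<close>; adding the two convexity bounds removes \<open>t\<close>.\<close>

lemma convex_on_pair_sum_le:
  fixes g :: "real \<Rightarrow> real"
  assumes g: "convex_on UNIV g" and "a + b = c + d" "max a b \<le> max c d"
  shows "g a + g b \<le> g c + g d"
proof -
  have *: "g a + g b \<le> g c + g d"
    if "d \<le> c" "a + b = c + d" "a \<le> c" "b \<le> c" for a b c d
  proof (cases "c = d")
    case True
    then show ?thesis using that by (cases "a = c") auto
  next
    case False
    \<comment> \<open>The relative position of \<open>a\<close> on the segment from \<open>d\<close>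
      to \<open>c\<close>; \<open>a \<ge> d\<close> follows from \<open>b \<le> c\<close> and the
      equal sums.\<close>
    define t where "t = (a - d) / (c - d)"
    have t: "0 \<le> t" "t \<le> 1"
      using that False by (auto simp: t_def divide_simps)
    have "t * (c - d) = a - d"
      using False by (simp add: t_def)
    hence ab: "a = (1 - t) * d + t * c" "b = (1 - t) * c + t * d"
      using that(2) by (auto simp: algebra_simps)
    have "g a \<le> (1 - t) * g d + t * g c" "g b \<le> (1 - t) * g c + t * g d"
      unfolding ab using convex_onD[OF g t, of d c] convex_onD[OF g t, of c d] by simp_all
    thus ?thesis by (simp add: algebra_simps)
  qed
  show ?thesis
    using *[where a = a and b = b and c = c and d = d] *[where a = a and b = b and c = d and d = c] assms
    by (cases "d \<le> c") auto
qed

text \<open>The smaller weight multiplies the unweighted inequality for the pair. The surplus weight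
  sits at the larger of \<open>c\<close> and \<open>d\<close>, which bounds both \<open>a\<close>
  and \<open>b\<close>, so monotonicity of \<open>g\<close> handles it.\<close>

lemma weighted_pair_sum_le:
  fixes g :: "real \<Rightarrow> real"
  assumes g: "convex_on UNIV g" "mono g" and maj: "majorized [a, b] [c, d]"
    and w: "0 \<le> v" "0 \<le> w" and coupled: "d \<le> c \<and> v \<le> w \<or> c \<le> d \<and> w \<le> v"
  shows "w * g a + v * g b \<le> w * g c + v * g d"
proof -
  have eq: "a + b = c + d" and le: "max a b \<le> max c d"
    using maj by (auto simp: majorized_pair_iff)
  have sum: "g a + g b \<le> g c + g d"
    using convex_on_pair_sum_le[OF g(1) eq le] .
  from coupled show ?thesis
  proof
    assume *: "d \<le> c \<and> v \<le> w"
    hence "v * (g a + g b) + (w - v) * g a \<le> v * (g c + g d) + (w - v) * g c"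
      using w le
      by (intro add_mono[OF mult_left_mono[OF sum] mult_left_mono[OF monoD[OF g(2)]]]) auto
    thus ?thesis by (simp add: algebra_simps)
  next
    assume *: "c \<le> d \<and> w \<le> v"
    hence "w * (g a + g b) + (v - w) * g b \<le> w * (g c + g d) + (v - w) * g d"
      using w le
      by (intro add_mono[OF mult_left_mono[OF sum] mult_left_mono[OF monoD[OF g(2)]]]) auto
    thus ?thesis by (simp add: algebra_simps)
  qed
qed

section \<open>Monotonicity of the Levy weights along the order\<close>

text \<open>For admissible parameters and \<open>k \<ge> 1\<close> this is \<open>k\<close> times
  the mass at \<open>k\<close> of the Levy measure of the sum.\<close>

definition levy_weight :: "nat \<Rightarrow> real^'n \<Rightarrow> real^'n \<Rightarrow> real" where
  "levy_weight k x y = (\<Sum>i\<in>UNIV. max 0 (x $ i) * max 0 (1 - y $ i) ^ k)"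

lemma sum_le_of_pair:
  fixes f g :: "'i::finite \<Rightarrow> real"
  assumes "i \<noteq> j" "f i + f j \<le> g i + g j" "\<And>m. m \<noteq> i \<Longrightarrow> m \<noteq> j \<Longrightarrow> f m = g m"
  shows "sum f UNIV \<le> sum g UNIV"
proof -
  have split: "sum h UNIV = h i + h j + sum h (- {i, j})" for h :: "'i \<Rightarrow> real"
    using sum.subset_diff[of "{i, j}" UNIV h] assms(1) by (simp add: Compl_eq_Diff_UNIV)
  have "sum f (- {i, j}) = sum g (- {i, j})"
    using assms(3) by (intro sum.cong) auto
  thus ?thesis
    unfolding split[of f] split[of g] using assms(2) by simp
qed

lemma levy_weight_rc_rel_1:
  assumes "rc_rel_1 x1 y1 x2 y2"
  shows "levy_weight k x1 y1 \<le> levy_weight k x2 y2"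
proof -
  obtain i j where ij: "i \<noteq> j" and coupled: "(y2 $ j - y2 $ i) * (x2 $ j - x2 $ i) \<le> 0"
    and maj: "majorized [x1 $ i, x1 $ j] [x2 $ i, x2 $ j]"
    and rest: "\<And>m. m \<noteq> i \<Longrightarrow> m \<noteq> j \<Longrightarrow> x1 $ m = x2 $ m" and y: "y1 = y2"
    using assms unfolding rc_rel_1_def by blast
  let ?w = "\<lambda>i. max 0 (1 - y2 $ i) ^ k"
  \<comment> \<open>The reverse coupling of \<open>x2\<close> and \<open>y2\<close> orders
    \<open>x2\<close> and \<open>1 - y2\<close> alike. The exponent 1 below makes the convex
    function the positive part itself.\<close>
  have "x2 $ j \<le> x2 $ i \<and> ?w j \<le> ?w i \<or> x2 $ i \<le> x2 $ j \<and> ?w i \<le> ?w j"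
    using coupled by (auto simp: mult_le_0_iff intro!: power_mono max.mono)
  hence "?w i * max 0 (x1 $ i) ^ 1 + ?w j * max 0 (x1 $ j) ^ 1
      \<le> ?w i * max 0 (x2 $ i) ^ 1 + ?w j * max 0 (x2 $ j) ^ 1"
    by (intro weighted_pair_sum_le[OF convex_on_power_pos_part mono_power_pos_part maj]) auto
  with ij rest show ?thesis
    unfolding levy_weight_def y by (intro sum_le_of_pair[of i j]) (auto simp: mult.commute)
qed

lemma levy_weight_rc_rel_2:
  assumes "rc_rel_2 x1 y1 x2 y2"
  shows "levy_weight k x1 y1 \<le> levy_weight k x2 y2"
proof -
  obtain i j where ij: "i \<noteq> j" and coupled: "(y2 $ j - y2 $ i) * (x2 $ j - x2 $ i) \<le> 0"
    and maj: "majorized [y1 $ i, y1 $ j] [y2 $ i, y2 $ j]"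
    and rest: "\<And>m. m \<noteq> i \<Longrightarrow> m \<noteq> j \<Longrightarrow> y1 $ m = y2 $ m" and x: "x1 = x2"
    using assms unfolding rc_rel_2_def by blast
  \<comment> \<open>For pairs of equal sum, a bound on the maxima is the reverse bound on the
    minima, so reflection preserves majorization.\<close>
  have maj': "majorized [1 - y1 $ i, 1 - y1 $ j] [1 - y2 $ i, 1 - y2 $ j]"
    using maj by (auto simp: majorized_pair_iff max_def split: if_splits)
  let ?w = "\<lambda>i. max 0 (x2 $ i)"
  have "1 - y2 $ j \<le> 1 - y2 $ i \<and> ?w j \<le> ?w i \<or> 1 - y2 $ i \<le> 1 - y2 $ j \<and> ?w i \<le> ?w j"
    using coupled by (auto simp: mult_le_0_iff)
  hence "?w i * max 0 (1 - y1 $ i) ^ k + ?w j * max 0 (1 - y1 $ j) ^ k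
      \<le> ?w i * max 0 (1 - y2 $ i) ^ k + ?w j * max 0 (1 - y2 $ j) ^ k"
    by (intro weighted_pair_sum_le[OF convex_on_power_pos_part mono_power_pos_part maj']) auto
  with ij rest show ?thesis
    unfolding levy_weight_def x by (intro sum_le_of_pair[of i j]) auto
qed

lemma levy_weight_mono:
  assumes "\<And>i. x1 $ i \<le> x2 $ i" "\<And>i. y2 $ i \<le> y1 $ i"
  shows "levy_weight k x1 y1 \<le> levy_weight k x2 y2"
  unfolding levy_weight_def
  using assms by (intro sum_mono mult_mono power_mono max.mono) auto

lemma levy_weight_permute:
  assumes "((x, y), (x', y')) \<in> sim_perm"
  shows "levy_weight k x' y' = levy_weight k x y"
proof -
  obtain \<pi> where \<pi>: "bij \<pi>" "\<And>i. x' $ i = x $ \<pi> i" "\<And>i. y' $ i = y $ \<pi> i"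
    using assms unfolding sim_perm_def by auto
  thus ?thesis
    unfolding levy_weight_def \<pi>(2,3)
    by (intro sum.reindex_bij_betw[where g = "\<lambda>i. max 0 (x $ i) * max 0 (1 - y $ i) ^ k"])
qed

lemma pair_class_refl: "(x, y) \<in> pair_class x y"
  unfolding pair_class_def sim_perm_def by (auto intro!: exI[of _ id])

text \<open>The functional descends to classes; consecutive steps of a chain may use different
  representatives of the class they share.\<close>

lemma levy_weight_pair_class_eq:
  assumes "pair_class x y = pair_class x' y'"
  shows "levy_weight k x y = levy_weight k x' y'"
proof -
  have "(x, y) \<in> pair_class x' y'"
    using pair_class_refl[of x y] assms by simp
  thus ?thesis
    unfolding pair_class_def by (auto intro: levy_weight_permute)
qed

lemma levy_weight_rc_weak_subsup_le:
  assumes "rc_weak_subsup_le (pair_class x y) (pair_class x' y')"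
  shows "levy_weight k x y \<le> levy_weight k x' y'"
proof -
  \<comment> \<open>Quantifying over all representatives of \<open>D\<close> lets the next step
    choose its own.\<close>
  have "\<forall>u v. D = pair_class u v \<longrightarrow> levy_weight k x y \<le> levy_weight k u v"
    if "rc_step\<^sup>*\<^sup>* (pair_class x y) D" for D
    using that
  proof (induction rule: rtranclp_induct)
    case base
    show ?case
      by (metis levy_weight_pair_class_eq order_refl)
  next
    case (step C D)
    then obtain x1 y1 x2 y2 where C: "C = pair_class x1 y1" and D: "D = pair_class x2 y2"
      and rel: "rc_rel_1 x1 y1 x2 y2 \<or> rc_rel_2 x1 y1 x2 y2
        \<or> rc_rel_3 x1 y1 x2 y2 \<or> rc_rel_4 x1 y1 x2 y2"
      unfolding rc_step_def by blast
    have "levy_weight k x y \<le> levy_weight k x1 y1"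
      using step.IH C by blast
    also have "\<dots> \<le> levy_weight k x2 y2"
      using rel levy_weight_rc_rel_1 levy_weight_rc_rel_2
      by (auto simp: rc_rel_3_def rc_rel_4_def intro: levy_weight_mono)
    finally show ?case
      using D by (metis levy_weight_pair_class_eq)
  qed
  thus ?thesis
    using assms unfolding rc_weak_subsup_le_def by blast
qed

theorem theorem4p25:
  fixes \<alpha>1 p1 \<alpha>2 p2 :: "real^'n"
    and M1 :: "'a measure" and N1 :: "'n \<Rightarrow> 'a \<Rightarrow> nat"
    and M2 :: "'b measure" and N2 :: "'n \<Rightarrow> 'b \<Rightarrow> nat"
  assumes "\<And>i. 0 < \<alpha>1 $ i" and "\<And>i. 0 < p1 $ i \<and> p1 $ i < 1"
    and "\<And>i. 0 < \<alpha>2 $ i" and "\<And>i. 0 < p2 $ i \<and> p2 $ i < 1"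
    and "prob_space M1"
    and "\<And>i. neg_binomial_rv M1 (N1 i) (\<alpha>1 $ i) (p1 $ i)"
    and "prob_space.indep_vars M1 (\<lambda>_. count_space UNIV) N1 UNIV"
    and "prob_space M2"
    and "\<And>i. neg_binomial_rv M2 (N2 i) (\<alpha>2 $ i) (p2 $ i)"
    and "prob_space.indep_vars M2 (\<lambda>_. count_space UNIV) N2 UNIV"
    and "rc_weak_subsup_le (pair_class \<alpha>1 p1) (pair_class \<alpha>2 p2)"
  shows "conv_le M1 (\<lambda>\<omega>. \<Sum>i\<in>UNIV. real (N1 i \<omega>)) M2 (\<lambda>\<omega>. \<Sum>i\<in>UNIV. real (N2 i \<omega>))"
proof (rule conv_le_sum_neg_binomial)
  show "prob_space M1" "prob_space.indep_vars M1 (\<lambda>_. count_space UNIV) N1 UNIV"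
    "prob_space M2" "prob_space.indep_vars M2 (\<lambda>_. count_space UNIV) N2 UNIV"
    by fact+
  show "neg_binomial_rv M1 (N1 i) (\<alpha>1 $ i) (p1 $ i)" "neg_binomial_rv M2 (N2 i) (\<alpha>2 $ i) (p2 $ i)"
    "0 < p1 $ i" "0 < p2 $ i" for i
    using assms by simp_all
  have pos_part: "levy_weight k x y = (\<Sum>i\<in>UNIV. x $ i * (1 - y $ i) ^ k)"
    if "\<And>i. 0 < x $ i" "\<And>i. 0 < y $ i \<and> y $ i < 1" for k and x y :: "real^'n"
    unfolding levy_weight_def using that by (intro sum.cong) (simp_all add: max_def less_imp_le)
  \<comment> \<open>The exponent is \<open>Suc k\<close> because the coefficient of index
    \<open>k\<close> in a logarithmic derivative belongs to the Levy mass at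
    \<open>k + 1\<close>.\<close>
  show "(\<Sum>i\<in>UNIV. \<alpha>1 $ i * (1 - p1 $ i) ^ Suc k) \<le> (\<Sum>i\<in>UNIV. \<alpha>2 $ i * (1 - p2 $ i) ^ Suc k)" for k
    using levy_weight_rc_weak_subsup_le[OF assms(11), of "Suc k"]
    unfolding pos_part[OF assms(1,2)] pos_part[OF assms(3,4)] .
qed

end
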